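(* Let $\mathcal{H}_S=\mathcal{H}_L\otimes\mathcal{H}_A$ be finite-dimensional with $d_L=\dim\mathcal{H}_L$, $d_S=\dim\mathcal{H}_S\geq 2$, and let $|0\rangle_A\in\mathcal{H}_A$ be a fixed unit vector. For a unitary $U\in\mathbf{U}(d_S)$ on $\mathcal{H}_S$ let $\mathcal{E}=\mathcal{E}_U$ be the isometric encoding channel $\mathcal{E}(\rho)=W\rho W^{\dagger}$ with $W=U(\mathbf{1}_L\otimes|0\rangle_A)$. Let $\mathbf{G}$ be the group $U(1)$, represented by $U_L(g)=e^{-iH_L^*g}$ on $\mathcal{H}_L$ and $U_S(g)=e^{-iH_Sg}$ on $\mathcal{H}_S$, where $H_L$ and $H_S$ are Hermitian. Then, with $\mu$ the normalized Haar measure on the unitary group $\mathbf{U}(d_S)$, the average noncovariance is $$\int_{\mathbf{U}(d_S)}N_{\mathbf{G}}(\mathcal{E})\,d\mu(U)=\frac{d_L\,\mathrm{tr}(H_L^2)-(\mathrm{tr}H_L)^2}{d_L^2}+\frac{(d_Ld_S^2-d_S)\,\mathrm{tr}(H_S^2)-(d_Ld_S-1)(\mathrm{tr}H_S)^2}{d_Ld_S(d_S^2-1)}.$$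
   Context: $H_L^*$ is the entrywise complex conjugate of $H_L$ in a fixed orthonormal basis $\{|k\rangle\}$ of $\mathcal{H}_L$. $R$ is a reference system identical to $L$, $|\psi\rangle_{LR}=\frac{1}{\sqrt{d_L}}\sum_{k=1}^{d_L}|k\rangle_L|k\rangle_R$, and $|\tilde\psi\rangle_{LS}=(\mathbf{1}_L\otimes W_{R\to S})|\psi\rangle_{LR}$ (so $|\tilde\psi\rangle\langle\tilde\psi|$ is the Choi state of $\mathcal{E}$). The generator of $U_L^*(g)\otimes U_S(g)$ is $H=\mathbf{1}_L\otimes H_S-H_L\otimes\mathbf{1}_S$. The noncovariance of $\mathcal{E}$ with respect to $\mathbf{G}=U(1)$ is the Wigner-Yanase skew information $$N_{\mathbf{G}}(\mathcal{E})=I\left(|\tilde\psi\rangle\langle\tilde\psi|,H\right),\qquad I(\rho,H)=-\frac12\mathrm{tr}\left([\sqrt\rho,H]^2\right),$$ which for the pure state $|\tilde\psi\rangle$ equals $\langle\tilde\psi|H^2|\tilde\psi\rangle-\langle\tilde\psi|H|\tilde\psi\rangle^2$. *)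

theory Defs
  imports "HOL-Analysis.Analysis"
begin

section \<open>Complex matrices\<close>

text \<open>
  A matrix from \<open>complex ^ 'n ^ 'm\<close> has rows indexed by \<open>'m\<close> and columns indexed by \<open>'n\<close>.
  Pitfall: on nested vectors, \<open>*\<close> and \<open>^\<close> of the library are componentwise; the matrix product
  is \<open>**\<close>, and scalar multiples and powers are introduced here.
\<close>

definition mat_scale :: "complex \<Rightarrow> complex ^ 'n ^ 'm \<Rightarrow> complex ^ 'n ^ 'm" where
  "mat_scale c A = (\<chi> i j. c * A $ i $ j)"

definition mat_cnj :: "complex ^ 'n ^ 'm \<Rightarrow> complex ^ 'n ^ 'm" where
  "mat_cnj A = (\<chi> i j. cnj (A $ i $ j))"

definition mat_adj :: "complex ^ 'n ^ 'm \<Rightarrow> complex ^ 'm ^ 'n" where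
  "mat_adj A = (\<chi> i j. cnj (A $ j $ i))"

definition hermitian :: "complex ^ 'n ^ 'n \<Rightarrow> bool" where
  "hermitian A \<longleftrightarrow> mat_adj A = A"

definition unitary_group :: "(complex ^ 'n ^ 'n) set" where
  "unitary_group = {U. mat_adj U ** U = mat 1 \<and> U ** mat_adj U = mat 1}"

definition cinner_vec :: "complex ^ 'n \<Rightarrow> complex ^ 'n \<Rightarrow> complex" where
  "cinner_vec u v = (\<Sum>i\<in>UNIV. cnj (u $ i) * v $ i)"

definition pos_semidef :: "complex ^ 'n ^ 'n \<Rightarrow> bool" where
  "pos_semidef A \<longleftrightarrow> hermitian A \<and> (\<forall>v. 0 \<le> Re (cinner_vec v (A *v v)))"

text \<open>A positive semidefinite matrix has exactly one positive semidefinite square root.\<close>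

definition mat_sqrt :: "complex ^ 'n ^ 'n \<Rightarrow> complex ^ 'n ^ 'n" where
  "mat_sqrt A = (THE S. pos_semidef S \<and> S ** S = A)"

definition mat_pow :: "complex ^ 'n ^ 'n \<Rightarrow> nat \<Rightarrow> complex ^ 'n ^ 'n" where
  "mat_pow A n = (((**) A) ^^ n) (mat 1)"

definition mat_exp :: "complex ^ 'n ^ 'n \<Rightarrow> complex ^ 'n ^ 'n" where
  "mat_exp A = (\<Sum>n. mat_pow A n /\<^sub>R fact n)"

definition kron :: "complex ^ 'n ^ 'm \<Rightarrow> complex ^ 'q ^ 'p \<Rightarrow> complex ^ ('n::finite \<times> 'q::finite) ^ ('m::finite \<times> 'p::finite)" where
  "kron A B = (\<chi> r c. A $ fst r $ fst c * B $ snd r $ snd c)"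

definition ket_bra :: "complex ^ 'n \<Rightarrow> complex ^ 'n ^ 'n" where
  "ket_bra v = (\<chi> i j. v $ i * cnj (v $ j))"


section \<open>Unitary representations and their generators\<close>

text \<open>
  \<open>U(1)\<close> enters through its angle \<open>g\<close>: a representation is given as the function
  \<open>g \<mapsto> exp (- i H g)\<close> on the reals.
\<close>

definition rep_of :: "complex ^ 'n ^ 'n \<Rightarrow> real \<Rightarrow> complex ^ 'n ^ 'n" where
  "rep_of H g = mat_exp (mat_scale (- \<i> * of_real g) H)"

text \<open>The generator of \<open>V g = exp (- i H g)\<close> is \<open>H = i V'(0)\<close>.\<close>

definition generator :: "(real \<Rightarrow> complex ^ 'n ^ 'n) \<Rightarrow> complex ^ 'n ^ 'n" where
  "generator V = mat_scale \<i> (vector_derivative V (at 0))"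


section \<open>Channels, Choi states and noncovariance\<close>

text \<open>
  \<open>'l\<close> indexes the fixed orthonormal basis of the logical system \<open>L\<close> (and of its copy \<open>R\<close>),
  \<open>'a\<close> that of \<open>A\<close>. \<open>attach a\<close> is the isometry \<open>1\<^sub>L \<otimes> |a\<rangle>\<close> from \<open>L\<close> to \<open>L \<otimes> A\<close>.
\<close>

definition attach :: "complex ^ 'a \<Rightarrow> complex ^ 'l ^ ('l::finite \<times> 'a::finite)" where
  "attach a = (\<chi> p k. if fst p = k then a $ snd p else 0)"

definition isometric_channel ::
    "complex ^ 'l ^ 's \<Rightarrow> complex ^ 'l ^ 'l \<Rightarrow> complex ^ 's ^ 's" where
  "isometric_channel W \<rho> = W ** \<rho> ** mat_adj W"

definition encoding_isometry ::
    "complex ^ 'a \<Rightarrow> complex ^ ('l::finite \<times> 'a::finite) ^ ('l \<times> 'a) \<Rightarrow> complex ^ 'l ^ ('l \<times> 'a)" where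
  "encoding_isometry a U = U ** attach a"

definition encoding_channel ::
    "complex ^ 'a \<Rightarrow> complex ^ ('l::finite \<times> 'a::finite) ^ ('l \<times> 'a) \<Rightarrow>
     complex ^ 'l ^ 'l \<Rightarrow> complex ^ ('l \<times> 'a) ^ ('l \<times> 'a)" where
  "encoding_channel a U = isometric_channel (encoding_isometry a U)"

definition max_entangled :: "complex ^ ('l::finite \<times> 'l)" where
  "max_entangled = (\<chi> p. if fst p = snd p then 1 / of_real (sqrt (real CARD('l))) else 0)"

text \<open>\<open>id \<otimes> \<Phi>\<close> applies \<open>\<Phi>\<close> to every block of a matrix over \<open>L \<otimes> R\<close>.\<close>

definition ampliation ::
    "(complex ^ 'r::finite ^ 'r \<Rightarrow> complex ^ 's ^ 's) \<Rightarrow>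
     complex ^ ('l::finite \<times> 'r) ^ ('l \<times> 'r) \<Rightarrow> complex ^ ('l \<times> 's::finite) ^ ('l \<times> 's)" where
  "ampliation \<Phi> X =
     (\<chi> p q. \<Phi> (\<chi> k m. X $ (fst p, k) $ (fst q, m)) $ snd p $ snd q)"

definition choi_state ::
    "(complex ^ 'l ^ 'l \<Rightarrow> complex ^ 's ^ 's) \<Rightarrow> complex ^ ('l::finite \<times> 's::finite) ^ ('l \<times> 's)" where
  "choi_state \<Phi> = ampliation \<Phi> (ket_bra max_entangled)"

definition commutator :: "complex ^ 'n ^ 'n \<Rightarrow> complex ^ 'n ^ 'n \<Rightarrow> complex ^ 'n ^ 'n" where
  "commutator A B = A ** B - B ** A"

definition skew_information :: "complex ^ 'n ^ 'n \<Rightarrow> complex ^ 'n ^ 'n \<Rightarrow> complex" where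
  "skew_information \<rho> H =
     - (1 / 2) * trace (commutator (mat_sqrt \<rho>) H ** commutator (mat_sqrt \<rho>) H)"

definition noncovariance ::
    "(real \<Rightarrow> complex ^ 'l ^ 'l) \<Rightarrow> (real \<Rightarrow> complex ^ 's ^ 's) \<Rightarrow>
     (complex ^ 'l ^ 'l \<Rightarrow> complex ^ 's ^ 's) \<Rightarrow> complex" where
  "noncovariance U\<^sub>L U\<^sub>S \<Phi> =
     skew_information (choi_state \<Phi>) (generator (\<lambda>g. kron (mat_cnj (U\<^sub>L g)) (U\<^sub>S g)))"


section \<open>Haar measure\<close>

text \<open>Haar measure is characterised by left invariance; it is unique and bi-invariant since the
  group is compact.\<close>

definition normalized_haar :: "(complex ^ 'n ^ 'n) measure \<Rightarrow> bool" where
  "normalized_haar \<mu> \<longleftrightarrow>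
     sets \<mu> = sets (restrict_space borel unitary_group) \<and>
     emeasure \<mu> (space \<mu>) = 1 \<and>
     (\<forall>V\<in>unitary_group. distr \<mu> \<mu> (\<lambda>U. V ** U) = \<mu>)"


section \<open>Consistency of the definitions\<close>

text \<open>The Choi state of an isometric channel is the pure state of \<open>(1 \<otimes> W) |\<psi>\<rangle>\<close>.\<close>

lemma choi_state_isometric_channel:
  fixes W :: "complex ^ 'l ^ 's"
  shows "choi_state (isometric_channel W) = ket_bra (kron (mat 1) W *v max_entangled)"
proof -
  define c :: complex where "c = 1 / of_real (sqrt (real CARD('l)))"
  have me: "(max_entangled :: complex ^ ('l::finite \<times> 'l)) $ (i, j) = (if i = j then c else 0)" for i j
    by (simp add: max_entangled_def c_def)
  have k: "(kron (mat 1) W *v max_entangled) $ (i, s) = W $ s $ i * c" for i :: 'l and s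
  proof -
    have "(kron (mat 1) W *v max_entangled) $ (i, s)
        = (\<Sum>(k, m)\<in>UNIV \<times> UNIV. (if i = k then 1 else 0) * W $ s $ m * (if k = m then c else 0))"
      by (simp add: matrix_vector_mult_def kron_def mat_def UNIV_Times_UNIV[symmetric]
          case_prod_unfold max_entangled_def c_def cong: if_cong del: UNIV_Times_UNIV)
    also have "\<dots> = (\<Sum>k\<in>UNIV. \<Sum>m\<in>UNIV. (if i = k then 1 else 0) * W $ s $ m * (if k = m then c else 0))"
      by (simp add: sum.cartesian_product)
    also have "\<dots> = (\<Sum>k\<in>UNIV. if i = k then W $ s $ k * c else 0)"
    proof (rule sum.cong[OF refl])
      fix k
      have "(\<Sum>m\<in>UNIV. (if i = k then 1 else 0) * W $ s $ m * (if k = m then c else 0))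
          = (\<Sum>m\<in>UNIV. if k = m then (if i = k then W $ s $ m * c else 0) else 0)"
        by (rule sum.cong) auto
      also have "\<dots> = (if i = k then W $ s $ k * c else 0)" by simp
      finally show "(\<Sum>m\<in>UNIV. (if i = k then 1 else 0) * W $ s $ m * (if k = m then c else 0))
          = (if i = k then W $ s $ k * c else 0)" .
    qed
    also have "\<dots> = W $ s $ i * c" by simp
    finally show ?thesis .
  qed
  have l: "choi_state (isometric_channel W) $ (i, s) $ (j, t)
      = (W $ s $ i * c) * cnj (W $ t $ j * c)" for i j s t
  proof -
    have "choi_state (isometric_channel W) $ (i, s) $ (j, t) =
       (\<Sum>m\<in>UNIV. (\<Sum>k\<in>UNIV. W $ s $ k * ((if i = k then c else 0) * cnj (if j = m then c else 0)))
          * cnj (W $ t $ m))"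
      by (simp add: choi_state_def ampliation_def isometric_channel_def matrix_matrix_mult_def
          mat_adj_def ket_bra_def me)
    also have "\<dots> = (\<Sum>m\<in>UNIV. if j = m then (W $ s $ i * c) * cnj (c) * cnj (W $ t $ m) else 0)"
    proof (rule sum.cong[OF refl])
      fix m
      have "(\<Sum>k\<in>UNIV. W $ s $ k * ((if i = k then c else 0) * cnj (if j = m then c else 0)))
          = (\<Sum>k\<in>UNIV. if i = k then W $ s $ k * (c * cnj (if j = m then c else 0)) else 0)"
        by (rule sum.cong) auto
      then show "(\<Sum>k\<in>UNIV. W $ s $ k * ((if i = k then c else 0) * cnj (if j = m then c else 0)))
          * cnj (W $ t $ m) = (if j = m then (W $ s $ i * c) * cnj (c) * cnj (W $ t $ m) else 0)"
        by (simp add: mult.assoc)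
    qed
    also have "\<dots> = (W $ s $ i * c) * cnj (W $ t $ j * c)" by (simp add: mult.assoc mult.commute)
    finally show ?thesis .
  qed
  show ?thesis
    by (simp add: vec_eq_iff l k ket_bra_def split_paired_all)
qed

text \<open>The generator of \<open>U\<^sub>L\<^sup>*(g) \<otimes> U\<^sub>S(g)\<close> is \<open>1 \<otimes> H\<^sub>S - H\<^sub>L \<otimes> 1\<close>.\<close>

lemma norm_mat_pow_le:
  fixes A :: "complex ^ 'n ^ 'n"
  defines "b \<equiv> (\<Sum>i\<in>UNIV. \<Sum>j\<in>UNIV. cmod (A $ i $ j))"
  shows "cmod (mat_pow A n $ i $ j) \<le> b ^ n"
proof (induction n arbitrary: i j)
  case 0
  then show ?case by (simp add: mat_pow_def mat_def)
next
  case (Suc n)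
  have b0: "0 \<le> b" by (simp add: b_def sum_nonneg)
  have row: "(\<Sum>k\<in>UNIV. cmod (A $ i $ k)) \<le> b"
    unfolding b_def
    by (rule member_le_sum[where f = "\<lambda>i. \<Sum>k\<in>UNIV. cmod (A $ i $ k)"]) (auto intro: sum_nonneg)
  have "mat_pow A (Suc n) $ i $ j = (\<Sum>k\<in>UNIV. A $ i $ k * mat_pow A n $ k $ j)"
    by (simp add: mat_pow_def matrix_matrix_mult_def)
  also have "cmod \<dots> \<le> (\<Sum>k\<in>UNIV. cmod (A $ i $ k) * b ^ n)"
    by (rule sum_norm_le) (simp add: norm_mult mult_left_mono Suc)
  also have "\<dots> = (\<Sum>k\<in>UNIV. cmod (A $ i $ k)) * b ^ n" by (simp add: sum_distrib_right)
  also have "\<dots> \<le> b * b ^ n" using row b0 by (simp add: mult_right_mono)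
  finally show ?case by simp
qed

lemma mat_pow_scale: "mat_pow (mat_scale c A) n = mat_scale (c ^ n) (mat_pow A n)"
proof (induction n)
  case 0
  then show ?case by (simp add: mat_pow_def mat_scale_def vec_eq_iff)
next
  case (Suc n)
  have "mat_pow (mat_scale c A) (Suc n) = mat_scale c A ** mat_scale (c ^ n) (mat_pow A n)"
    using Suc by (simp add: mat_pow_def)
  also have "\<dots> = mat_scale (c ^ Suc n) (mat_pow A (Suc n))"
    by (simp add: mat_scale_def matrix_matrix_mult_def vec_eq_iff mat_pow_def sum_distrib_left
        algebra_simps)
  finally show ?case .
qed

lemma mat_pow_power_summable:
  "summable (\<lambda>n. (mat_pow A n $ i $ j / fact n) * z ^ n)" for z :: complex
proof -
  define b where "b = (\<Sum>i\<in>UNIV. \<Sum>j\<in>UNIV. cmod (A $ i $ j))"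
  show ?thesis
  proof (rule summable_comparison_test'[where g = "\<lambda>n. (b * cmod z) ^ n / fact n" and N = 0])
    show "summable (\<lambda>n. (b * cmod z) ^ n / fact n)"
      using summable_exp[of "b * cmod z"] by (simp add: field_simps)
    fix n
    show "norm ((mat_pow A n $ i $ j / fact n) * z ^ n) \<le> (b * cmod z) ^ n / fact n"
      using norm_mat_pow_le[of A n i j, folded b_def]
      by (simp add: norm_mult norm_divide norm_power power_mult_distrib divide_right_mono
          mult_right_mono)
  qed
qed

lemma mat_exp_nth: "mat_exp A $ i $ j = (\<Sum>n. mat_pow A n $ i $ j / fact n)"
proof -
  have "(\<lambda>n. mat_pow A n /\<^sub>R fact n) sums (\<chi> i j. \<Sum>n. mat_pow A n $ i $ j / fact n)"
    unfolding sums_def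
  proof (intro vec_tendstoI)
    fix i j
    have "(\<lambda>n. mat_pow A n $ i $ j / fact n) sums (\<Sum>n. mat_pow A n $ i $ j / fact n)"
      using mat_pow_power_summable[of A i j 1] by (simp add: summable_sums)
    moreover have "z /\<^sub>R fact n = z / fact n" for z :: complex and n
      by (simp add: scaleR_conv_of_real divide_inverse mult.commute)
    ultimately show "((\<lambda>n. (\<Sum>m<n. mat_pow A m /\<^sub>R fact m) $ i $ j) \<longlongrightarrow>
         (\<chi> i j. \<Sum>n. mat_pow A n $ i $ j / fact n) $ i $ j) sequentially"
      by (simp add: sums_def)
  qed
  then show ?thesis by (simp add: mat_exp_def sums_iff)
qed

lemma rep_of_nth:
  "rep_of H t $ i $ j = (\<Sum>n. (mat_pow H n $ i $ j / fact n) * (- \<i> * of_real t) ^ n)"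
  by (simp add: rep_of_def mat_exp_nth mat_pow_scale) (simp add: mat_scale_def mult.commute)

lemma rep_of_0: "rep_of H 0 = mat 1"
proof -
  have "rep_of H 0 $ i $ j = mat 1 $ i $ j" for i j
  proof -
    have "rep_of H 0 $ i $ j = (\<Sum>n. (mat_pow H n $ i $ j / fact n) * 0 ^ n)"
      by (simp add: rep_of_nth)
    also have "\<dots> = mat_pow H 0 $ i $ j" by (subst powser_zero) simp
    finally show ?thesis by (simp add: mat_pow_def)
  qed
  then show ?thesis by (simp add: vec_eq_iff)
qed

lemma rep_of_nth_derivative:
  "((\<lambda>t. rep_of H t $ i $ j) has_vector_derivative (- \<i> * H $ i $ j)) (at 0)"
proof -
  define c where "c n = mat_pow H n $ i $ j / fact n" for n
  have "((\<lambda>z. \<Sum>n. c n * z ^ n) has_field_derivative (\<Sum>n. diffs c n * 0 ^ n)) (at 0)"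
    unfolding c_def by (intro termdiffs_strong_converges_everywhere mat_pow_power_summable)
  moreover have "(\<Sum>n. diffs c n * 0 ^ n) = H $ i $ j"
    by (subst powser_zero) (simp add: diffs_def c_def mat_pow_def)
  ultimately have *: "((\<lambda>z. \<Sum>n. c n * z ^ n) has_field_derivative H $ i $ j) (at (- \<i> * of_real 0))"
    by simp
  have "((\<lambda>t::real. - \<i> * of_real t) has_vector_derivative - \<i>) (at 0)"
    by (auto intro!: derivative_eq_intros)
  from field_vector_diff_chain_at[OF this *] show ?thesis
    by (simp add: rep_of_nth[abs_def] c_def o_def)
qed

lemma has_vector_derivative_matI:
  fixes V :: "real \<Rightarrow> complex ^ 'n ^ 'n"
  assumes "\<And>i j. ((\<lambda>t. V t $ i $ j) has_vector_derivative D $ i $ j) (at x)"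
  shows "(V has_vector_derivative D) (at x)"
proof -
  have "((\<lambda>y. (1 / norm (y - x)) *\<^sub>R (V y - (V x + (y - x) *\<^sub>R D))) \<longlongrightarrow> 0) (at x)"
  proof (intro vec_tendstoI)
    fix i j
    have "((\<lambda>y. (1 / norm (y - x)) *\<^sub>R (V y $ i $ j - (V x $ i $ j + (y - x) *\<^sub>R D $ i $ j))) \<longlongrightarrow> 0) (at x)"
      using assms[of i j] by (simp add: has_vector_derivative_def has_derivative_within)
    then show "((\<lambda>y. ((1 / norm (y - x)) *\<^sub>R (V y - (V x + (y - x) *\<^sub>R D))) $ i $ j) \<longlongrightarrow> 0 $ i $ j) (at x)"
      by simp
  qed
  then show ?thesis
    by (simp add: has_vector_derivative_def has_derivative_within bounded_linear_scaleR_left)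
qed

lemma generator_kron_rep:
  fixes H\<^sub>L :: "complex ^ 'a ^ 'a" and H\<^sub>S :: "complex ^ 'b ^ 'b"
  shows "generator (\<lambda>g. kron (mat_cnj (rep_of (mat_cnj H\<^sub>L) g)) (rep_of H\<^sub>S g))
   = kron (mat 1) H\<^sub>S - kron H\<^sub>L (mat 1)"
  (is "generator ?V = ?H")
proof -
  have "(?V has_vector_derivative mat_scale (- \<i>) ?H) (at 0)"
  proof (rule has_vector_derivative_matI)
    fix p q :: "'a \<times> 'b"
    have "((\<lambda>t. cnj (rep_of (mat_cnj H\<^sub>L) t $ fst p $ fst q)) has_vector_derivative
         cnj (- \<i> * mat_cnj H\<^sub>L $ fst p $ fst q)) (at 0)"
      by (intro has_vector_derivative_cnj rep_of_nth_derivative)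
    from has_vector_derivative_mult[OF this rep_of_nth_derivative[of H\<^sub>S "snd p" "snd q"]]
    show "((\<lambda>t. ?V t $ p $ q) has_vector_derivative mat_scale (- \<i>) ?H $ p $ q) (at 0)"
      by (simp add: kron_def mat_cnj_def mat_scale_def rep_of_0 mat_def algebra_simps
          split: if_splits)
  qed
  then have "vector_derivative ?V (at 0) = mat_scale (- \<i>) ?H"
    by (rule vector_derivative_at)
  then show ?thesis
    by (simp add: generator_def mat_scale_def vec_eq_iff)
qed

end

theory Submission
  imports Defs
begin

text \<open>
  For the pure Choi state the square root is the state itself, so the skew information is the
  variance of \<open>1 \<otimes> H\<^sub>S - H\<^sub>L \<otimes> 1\<close>. Writing \<open>W\<close> as a vector of \<open>L \<otimes> S\<close>, this generator acts as
  \<open>M \<mapsto> H\<^sub>S M - M H\<^sub>L\<^sup>T\<close>, and the variance becomes a polynomial in traces \<open>tr (A U K U\<^sup>\<dagger>)\<close>. Only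
  their first and second Haar moments are needed, and these follow without representation theory:
  invariance under diagonal phases and permutations determines the correlations of the entries of
  \<open>U K U\<^sup>\<dagger>\<close> up to three constants, a Hadamard matrix on two coordinates gives one linear relation
  between them, and the invariants \<open>tr K\<close> and \<open>tr K\<^sup>2\<close> fix the rest.
\<close>

section \<open>Integration over the unitary group\<close>

text \<open>Closed, because the defining equations are polynomial in the entries and their
  conjugates; bounded, because the columns are unit vectors and so no entry exceeds modulus
  1.\<close>

lemma compact_unitary_group: "compact (unitary_group :: (complex ^ 'n ^ 'n) set)"
proof -
  have "closed (unitary_group :: (complex ^ 'n ^ 'n) set)"
    unfolding unitary_group_def vec_eq_iff matrix_matrix_mult_def mat_adj_def
    by (intro closed_Collect_conj closed_Collect_all closed_Collect_eq)
       (auto intro!: continuous_intros)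
  moreover have "bounded (unitary_group :: (complex ^ 'n ^ 'n) set)"
  proof -
    have entry: "cmod (U $ i $ j) \<le> 1" if "U \<in> unitary_group" for U :: "complex ^ 'n ^ 'n" and i j
    proof -
      have "(mat_adj U ** U) $ j $ j = 1"
        using that by (simp add: unitary_group_def mat_def)
      then have "(\<Sum>k\<in>UNIV. complex_of_real ((cmod (U $ k $ j))\<^sup>2)) = 1"
        by (simp add: matrix_matrix_mult_def mat_adj_def complex_norm_square mult.commute del: of_real_power)
      then have "(\<Sum>k\<in>UNIV. (cmod (U $ k $ j))\<^sup>2) = 1"
        by (metis of_real_sum of_real_eq_1_iff)
      moreover have "(cmod (U $ i $ j))\<^sup>2 \<le> (\<Sum>k\<in>UNIV. (cmod (U $ k $ j))\<^sup>2)"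
        by (rule member_le_sum) auto
      ultimately show ?thesis by (simp add: abs_square_le_1)
    qed
    have "norm U \<le> real CARD('n) * real CARD('n)" if "U \<in> unitary_group" for U :: "complex ^ 'n ^ 'n"
    proof -
      have "norm U \<le> (\<Sum>i\<in>UNIV. norm (U $ i))"
        unfolding norm_vec_def by (rule L2_set_le_sum) simp
      also have "\<dots> \<le> (\<Sum>i\<in>UNIV. \<Sum>j\<in>UNIV. norm (U $ i $ j))"
        unfolding norm_vec_def[where 'a = complex] by (intro sum_mono L2_set_le_sum) simp
      also have "\<dots> \<le> (\<Sum>i\<in>(UNIV::'n set). \<Sum>j\<in>(UNIV::'n set). 1)"
        by (intro sum_mono entry that)
      finally show ?thesis by simp
    qed
    then show ?thesis unfolding bounded_iff by blast
  qed
  ultimately show ?thesis by (simp add: compact_eq_bounded_closed)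
qed

section \<open>Products of unitaries and continuity of the matrix operations\<close>

lemma mat_adj_mult: "mat_adj (A ** B) = mat_adj B ** mat_adj A"
  by (simp add: mat_adj_def matrix_matrix_mult_def vec_eq_iff mult.commute)

lemma unitary_group_mult:
  assumes "V \<in> unitary_group" "U \<in> unitary_group"
  shows "V ** U \<in> unitary_group"
proof -
  have "mat_adj U ** mat_adj V ** (V ** U) = mat_adj U ** (mat_adj V ** V) ** U"
    "V ** U ** (mat_adj U ** mat_adj V) = V ** (U ** mat_adj U) ** mat_adj V"
    by (simp_all only: matrix_mul_assoc)
  then show ?thesis using assms by (simp add: unitary_group_def mat_adj_mult)
qed

lemma continuous_on_mat_mult [continuous_intros]:
  fixes f :: "'t::topological_space \<Rightarrow> complex ^ 'n ^ 'm" and g :: "'t \<Rightarrow> complex ^ 'k ^ 'n"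
  assumes "continuous_on S f" "continuous_on S g"
  shows "continuous_on S (\<lambda>x. f x ** g x)"
  unfolding matrix_matrix_mult_def
  by (intro continuous_intros assms)

lemma continuous_on_mat_adj [continuous_intros]:
  assumes "continuous_on S f"
  shows "continuous_on S (\<lambda>x. mat_adj (f x))"
  unfolding mat_adj_def by (intro continuous_intros assms)

lemma continuous_on_trace [continuous_intros]:
  fixes f :: "'t::topological_space \<Rightarrow> complex ^ 'n ^ 'n"
  assumes "continuous_on S f"
  shows "continuous_on S (\<lambda>x. trace (f x))"
  unfolding trace_def by (intro continuous_intros assms)

section \<open>Haar integrals of continuous functions\<close>

lemma space_haar: "normalized_haar \<mu> \<Longrightarrow> space \<mu> = unitary_group"
  unfolding normalized_haar_def
  by (metis sets_eq_imp_space_eq space_restrict_space space_borel Int_UNIV_right Int_UNIV_left)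

lemma haar_measurable:
  fixes f :: "complex ^ 'n ^ 'n \<Rightarrow> complex"
  assumes "normalized_haar \<mu>" "continuous_on UNIV f"
  shows "f \<in> borel_measurable \<mu>"
proof -
  have "f \<in> borel_measurable (restrict_space borel unitary_group)"
    using assms(2) by (intro measurable_restrict_space1 borel_measurable_continuous_onI)
  moreover have "sets \<mu> = sets (restrict_space borel unitary_group)"
    using assms(1) by (simp add: normalized_haar_def)
  ultimately show ?thesis
    by (subst measurable_cong_sets[OF _ refl])
qed

text \<open>A continuous function is bounded on the compact unitary group, and \<open>\<mu>\<close>
  has total mass 1.\<close>

lemma haar_integrable:
  fixes f :: "complex ^ 'n ^ 'n \<Rightarrow> complex"
  assumes "normalized_haar \<mu>" "continuous_on UNIV f"
  shows "integrable \<mu> f"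
proof -
  interpret finite_measure \<mu>
    using assms(1) by (intro finite_measureI) (simp add: normalized_haar_def)
  have "bounded (f ` unitary_group)"
    using assms(2) by (intro compact_imp_bounded compact_continuous_image compact_unitary_group)
      (auto intro: continuous_on_subset)
  then obtain B where "\<And>U. U \<in> unitary_group \<Longrightarrow> norm (f U) \<le> B"
    by (auto simp: bounded_iff)
  then show ?thesis
    by (intro integrable_const_bound[of _ B] haar_measurable assms)
      (auto simp: space_haar[OF assms(1)] intro!: AE_I2)
qed

text \<open>Change of variables along \<open>distr\<close>; this is the form in which Haar
  invariance enters the moment computations.\<close>

lemma haar_left_invariant:
  fixes f :: "complex ^ 'n ^ 'n \<Rightarrow> complex"
  assumes "normalized_haar \<mu>" "continuous_on UNIV f" "V \<in> unitary_group"
  shows "(LINT U|\<mu>. f (V ** U)) = (LINT U|\<mu>. f U)"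
proof -
  have "(\<lambda>U. V ** U) \<in> measurable (restrict_space borel unitary_group) (restrict_space borel unitary_group)"
    using unitary_group_mult[OF assms(3)]
    by (intro measurable_restrict_space3 borel_measurable_continuous_onI continuous_intros) auto
  then have "(\<lambda>U. V ** U) \<in> measurable \<mu> \<mu>"
    using assms(1) measurable_cong_sets[of \<mu> "restrict_space borel unitary_group" \<mu> "restrict_space borel unitary_group"]
    by (simp add: normalized_haar_def)
  then have "(LINT U|distr \<mu> \<mu> (\<lambda>U. V ** U). f U) = (LINT U|\<mu>. f (V ** U))"
    by (rule integral_distr) (rule haar_measurable[OF assms(1,2)])
  then show ?thesis using assms(1,3) by (simp add: normalized_haar_def)
qed

section \<open>Haar moments of a conjugated matrix\<close>

lemma monomial_in_unitary_group:
  assumes "bij \<sigma>" "\<And>i. \<theta> i * cnj (\<theta> i) = 1"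
  shows "(\<chi> i j. if j = \<sigma> i then \<theta> i else 0) \<in> unitary_group"
proof -
  define V :: "complex ^ 'a ^ 'a" where "V = (\<chi> i j. if j = \<sigma> i then \<theta> i else 0)"
  \<comment> \<open>Injectivity of \<open>\<sigma>\<close> gives distinct rows disjoint supports,
    and each row holds a single phase.\<close>
  have "V ** mat_adj V = mat 1"
    using assms(2) bij_is_inj[OF assms(1)]
    by (simp add: V_def mat_adj_def mat_def matrix_matrix_mult_def vec_eq_iff if_distrib[of cnj]
        if_distrib[of "\<lambda>x. x * _"] sum.delta inj_eq cong: if_cong)
  moreover from this have "mat_adj V ** V = mat 1"
    by (simp add: matrix_left_right_inverse)
  ultimately show ?thesis by (simp add: unitary_group_def V_def)
qed

lemma conj_monomial:
  fixes p :: "complex ^ 'n ^ 'n"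
  assumes "V = (\<chi> i j. if j = \<sigma> i then \<theta> i else 0)"
  shows "(V ** p ** mat_adj V) $ s $ t = \<theta> s * cnj (\<theta> t) * p $ \<sigma> s $ \<sigma> t"
proof -
  have "(V ** p) $ s $ j = \<theta> s * p $ \<sigma> s $ j" for j
    by (simp add: assms matrix_matrix_mult_def if_distrib[of "\<lambda>x. x * _"] cong: if_cong)
  then have "(V ** p ** mat_adj V) $ s $ t = (\<Sum>j\<in>UNIV. \<theta> s * p $ \<sigma> s $ j * cnj (V $ t $ j))"
    by (simp add: matrix_matrix_mult_def[of "V ** p"] mat_adj_def)
  also have "\<dots> = (\<Sum>j\<in>UNIV. if j = \<sigma> t then \<theta> s * p $ \<sigma> s $ j * cnj (\<theta> t) else 0)"
    by (rule sum.cong) (auto simp: assms)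
  finally show ?thesis by simp
qed

text \<open>A named constant lets simplification work from \<open>inv_sqrt2_square\<close> and
  reality alone, without meeting square roots.\<close>

definition inv_sqrt2 :: complex where
  "inv_sqrt2 = of_real (1 / sqrt 2)"

lemma inv_sqrt2_square: "inv_sqrt2 * inv_sqrt2 = 1 / 2"
  by (simp add: inv_sqrt2_def flip: of_real_mult)

lemma cnj_inv_sqrt2 [simp]: "cnj inv_sqrt2 = inv_sqrt2"
  by (simp add: inv_sqrt2_def)

text \<open>For distinct \<open>j\<close> and \<open>k\<close>: the 2 by 2 Hadamard matrix on the
  coordinates \<open>j\<close>, \<open>k\<close>, and the identity on all others.\<close>

definition hadamard_on :: "'n \<Rightarrow> 'n \<Rightarrow> complex ^ 'n ^ 'n" where
  "hadamard_on j k = (\<chi> a c.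
     if a = j \<and> c \<in> {j, k} \<or> a = k \<and> c = j then inv_sqrt2
     else if a = k \<and> c = k then - inv_sqrt2
     else if a = c \<and> a \<noteq> j \<and> a \<noteq> k then 1 else 0)"

text \<open>The action on a coordinate vector \<open>f\<close>, to which the products with this
  matrix are reduced.\<close>

lemma hadamard_on_row_sum:
  fixes f :: "'n::finite \<Rightarrow> complex"
  assumes "j \<noteq> k"
  shows "(\<Sum>c\<in>UNIV. hadamard_on j k $ a $ c * f c)
    = (if a = j then inv_sqrt2 * (f j + f k)
       else if a = k then inv_sqrt2 * (f j - f k) else f a)"
proof -
  have UN: "sum g UNIV = sum g (UNIV - {j, k}) + g j + g k" for g :: "'n \<Rightarrow> complex"
    using assms by (simp add: sum.subset_diff[of "{j, k}" UNIV] add.assoc)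
  have D: "sum g (UNIV - {j, k}) = (if a = j \<or> a = k then 0 else f a)"
    if "\<And>c. c \<notin> {j, k} \<Longrightarrow> g c = (if c = a then f c else 0)" for g :: "'n \<Rightarrow> complex"
  proof -
    have "sum g (UNIV - {j, k}) = (\<Sum>c\<in>UNIV - {j, k}. if c = a then f c else 0)"
      by (rule sum.cong) (auto simp: that)
    then show ?thesis by auto
  qed
  show ?thesis
    unfolding UN by (subst D) (use assms in \<open>auto simp: hadamard_on_def algebra_simps\<close>)
qed

text \<open>The matrix is real and symmetric, so both unitarity equations say that it is an
  involution.\<close>

lemma hadamard_on_unitary:
  fixes j k :: "'n::finite"
  assumes "j \<noteq> k"
  shows "hadamard_on j k \<in> unitary_group"
proof -
  have "cnj (hadamard_on j k $ b $ a) = hadamard_on j k $ a $ b" for a b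
    using assms by (cases "a = j"; cases "a = k"; cases "b = j"; cases "b = k")
      (auto simp: hadamard_on_def)
  then have "mat_adj (hadamard_on j k) = hadamard_on j k"
    by (simp add: mat_adj_def vec_eq_iff)
  moreover have "hadamard_on j k ** hadamard_on j k = mat 1"
  proof -
    have "(hadamard_on j k ** hadamard_on j k) $ a $ b = mat 1 $ a $ b" for a b
    proof -
      have "(hadamard_on j k ** hadamard_on j k) $ a $ b =
        (if a = j then inv_sqrt2 * (hadamard_on j k $ j $ b + hadamard_on j k $ k $ b)
         else if a = k then inv_sqrt2 * (hadamard_on j k $ j $ b - hadamard_on j k $ k $ b)
         else hadamard_on j k $ a $ b)"
        by (simp add: matrix_matrix_mult_def hadamard_on_row_sum[OF assms])
      also have "\<dots> = mat 1 $ a $ b"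
        using assms
        by (cases "a = j"; cases "a = k"; cases "b = j"; cases "b = k")
           (auto simp: hadamard_on_def mat_def inv_sqrt2_square mult.left_commute[of inv_sqrt2])
      finally show ?thesis .
    qed
    then show ?thesis by (simp add: vec_eq_iff)
  qed
  ultimately show ?thesis by (simp add: unitary_group_def)
qed

text \<open>Row \<open>j\<close> is the sum of the basis vectors \<open>j\<close> and
  \<open>k\<close> divided by the square root of 2, and the entry is the quadratic form of
  \<open>p\<close> at that vector.\<close>

lemma conj_hadamard_on_diag:
  fixes p :: "complex ^ 'n ^ 'n"
  assumes "j \<noteq> k"
  shows "(hadamard_on j k ** p ** mat_adj (hadamard_on j k)) $ j $ j
    = (p $ j $ j + p $ j $ k + p $ k $ j + p $ k $ k) / 2"
proof -
  have c: "cnj (hadamard_on j k $ a $ b) = hadamard_on j k $ a $ b" for a b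
    by (simp add: hadamard_on_def)
  have "(hadamard_on j k ** p) $ j $ b = inv_sqrt2 * (p $ j $ b + p $ k $ b)" for b
    by (simp add: matrix_matrix_mult_def hadamard_on_row_sum[OF assms])
  then have "(hadamard_on j k ** p ** mat_adj (hadamard_on j k)) $ j $ j
    = (\<Sum>b\<in>UNIV. hadamard_on j k $ j $ b * (inv_sqrt2 * (p $ j $ b + p $ k $ b)))"
    by (simp add: matrix_matrix_mult_def[of "hadamard_on j k ** p"] mat_adj_def c mult.commute)
  also have "\<dots> = (inv_sqrt2 * inv_sqrt2) *
     (p $ j $ j + p $ j $ k + p $ k $ j + p $ k $ k)"
    unfolding hadamard_on_row_sum[OF assms] by (simp add: algebra_simps)
  finally show ?thesis by (simp add: inv_sqrt2_square)
qed

lemma trace_unitary_conj: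
  assumes "U \<in> unitary_group"
  shows "trace (U ** K ** mat_adj U) = trace K"
proof -
  have "trace (U ** K ** mat_adj U) = trace ((mat_adj U ** U) ** K)"
    by (simp add: trace_mul_sym[of _ "mat_adj U"] matrix_mul_assoc)
  then show ?thesis using assms by (simp add: unitary_group_def)
qed

lemma unitary_conj_mult:
  assumes "U \<in> unitary_group"
  shows "(U ** K ** mat_adj U) ** (U ** L ** mat_adj U) = U ** (K ** L) ** mat_adj U"
proof -
  have "(U ** K ** mat_adj U) ** (U ** L ** mat_adj U) = U ** K ** (mat_adj U ** U) ** L ** mat_adj U"
    by (simp only: matrix_mul_assoc)
  also have "mat_adj U ** U = mat 1" using assms by (simp add: unitary_group_def)
  finally show ?thesis by (simp add: matrix_mul_assoc)
qed

text \<open>One transposition sends \<open>s\<close> to \<open>j\<close>; a second moves the image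
  of \<open>t\<close> to \<open>k\<close>. The second fixes \<open>j\<close>, since that image and
  \<open>k\<close> both differ from \<open>j\<close>.\<close>

lemma ex_bij_pair:
  fixes s t j k :: 'a
  assumes "s \<noteq> t" "j \<noteq> k"
  shows "\<exists>\<sigma>. bij \<sigma> \<and> \<sigma> s = j \<and> \<sigma> t = k"
proof -
  define \<tau> where "\<tau> = Transposition.transpose (Transposition.transpose s j t) k \<circ> Transposition.transpose s j"
  have "Transposition.transpose s j t \<noteq> j"
    using assms(1) by (auto simp: Transposition.transpose_def split: if_splits)
  then show ?thesis using assms
    by (intro exI[of _ \<tau>]) (auto simp: \<tau>_def intro: bij_comp)
qed

lemma sum_if: "(\<Sum>x\<in>A. if P then f x else 0) = (if P then \<Sum>x\<in>A. f x else 0)"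
  by simp

text \<open>None of the factors \<i>, -\<i>, -1 equals 1. They are the ones produced by a phase \<i>
  on a single index.\<close>

lemma fixed_by_phase: "z = 0" if "z = \<i> * z \<or> z = - (\<i> * z) \<or> z = - z" for z :: complex
  using that by (auto simp: complex_eq_iff)

lemma of_nat_square_diff_1_neq_0:
  assumes "2 \<le> n"
  shows "(of_nat n :: complex)\<^sup>2 - 1 \<noteq> 0"
proof
  assume "(of_nat n :: complex)\<^sup>2 - 1 = 0"
  then have "n\<^sup>2 = 1" by (metis eq_iff_diff_eq_0 of_nat_eq_1_iff of_nat_power)
  then show False using assms by (simp add: power2_eq_square)
qed

text \<open>The locale is interpreted twice below: with the projector onto the code space and with
  the transposed \<open>H\<^sub>L\<close> transported into it.\<close>

locale haar_conjugation =
  fixes \<mu> :: "(complex ^ 'n ^ 'n) measure" and K :: "complex ^ 'n ^ 'n"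
  assumes haar: "normalized_haar \<mu>"
begin

lemma measure_haar [simp]: "measure \<mu> (space \<mu>) = 1"
  using haar by (simp add: normalized_haar_def measure_def)

definition conjugate :: "complex ^ 'n ^ 'n \<Rightarrow> complex ^ 'n ^ 'n" where
  "conjugate U = U ** K ** mat_adj U"

lemma continuous_on_conjugate [continuous_intros]: "continuous_on UNIV conjugate"
  unfolding conjugate_def by (intro continuous_intros)

lemma integrable_conjugate [simp]: "continuous_on UNIV f \<Longrightarrow> integrable \<mu> (\<lambda>U. f (conjugate U))"
  for f :: "complex ^ 'n ^ 'n \<Rightarrow> complex"
  by (intro haar_integrable haar continuous_on_compose2[OF _ continuous_on_conjugate]) auto

text \<open>Conjugating \<open>conjugate U\<close> by \<open>V\<close> gives
  \<open>conjugate (V ** U)\<close>, so left invariance of \<open>\<mu>\<close> makes the law of the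
  random matrix invariant under conjugation.\<close>

lemma invariant:
  fixes f :: "complex ^ 'n ^ 'n \<Rightarrow> complex"
  assumes "continuous_on UNIV f" "V \<in> unitary_group"
  shows "(LINT U|\<mu>. f (V ** conjugate U ** mat_adj V)) = (LINT U|\<mu>. f (conjugate U))"
proof -
  have "(LINT U|\<mu>. f (conjugate (V ** U))) = (LINT U|\<mu>. f (conjugate U))"
    by (rule haar_left_invariant[OF haar _ assms(2)])
       (intro continuous_on_compose2[OF assms(1) continuous_on_conjugate], auto)
  then show ?thesis by (simp add: conjugate_def mat_adj_mult matrix_mul_assoc)
qed

section \<open>Means and correlations of the entries\<close>

definition entry_mean :: "'n \<Rightarrow> 'n \<Rightarrow> complex" where
  "entry_mean s t = (LINT U|\<mu>. conjugate U $ s $ t)"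

text \<open>The second factor is not conjugated, to match the square of a trace rather than its
  squared modulus.\<close>

definition entry_corr :: "'n \<Rightarrow> 'n \<Rightarrow> 'n \<Rightarrow> 'n \<Rightarrow> complex" where
  "entry_corr s t u v = (LINT U|\<mu>. conjugate U $ s $ t * conjugate U $ u $ v)"

lemma entry_mean_monomial:
  assumes "bij \<sigma>" "\<And>i. \<theta> i * cnj (\<theta> i) = 1"
  shows "entry_mean s t = \<theta> s * cnj (\<theta> t) * entry_mean (\<sigma> s) (\<sigma> t)"
proof -
  note V = monomial_in_unitary_group[of \<sigma> \<theta>, OF assms]
  have "entry_mean s t = (LINT U|\<mu>. \<theta> s * cnj (\<theta> t) * conjugate U $ \<sigma> s $ \<sigma> t)"
    unfolding entry_mean_def
    by (subst invariant[OF _ V, symmetric]) (auto intro!: continuous_intros simp: conj_monomial[OF refl])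
  then show ?thesis by (simp add: entry_mean_def)
qed

lemma entry_corr_monomial:
  assumes "bij \<sigma>" "\<And>i. \<theta> i * cnj (\<theta> i) = 1"
  shows "entry_corr s t u v = \<theta> s * cnj (\<theta> t) * \<theta> u * cnj (\<theta> v) * entry_corr (\<sigma> s) (\<sigma> t) (\<sigma> u) (\<sigma> v)"
proof -
  note V = monomial_in_unitary_group[of \<sigma> \<theta>, OF assms]
  have "entry_corr s t u v = (LINT U|\<mu>. (\<theta> s * cnj (\<theta> t) * \<theta> u * cnj (\<theta> v)) *
      (conjugate U $ \<sigma> s $ \<sigma> t * conjugate U $ \<sigma> u $ \<sigma> v))"
    unfolding entry_corr_def
    by (subst invariant[OF _ V, symmetric])
       (auto intro!: continuous_intros simp only: conj_monomial[OF refl] mult_ac)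
  also have "\<dots> = \<theta> s * cnj (\<theta> t) * \<theta> u * cnj (\<theta> v) * entry_corr (\<sigma> s) (\<sigma> t) (\<sigma> u) (\<sigma> v)"
    unfolding entry_corr_def by (rule Bochner_Integration.integral_mult_right_zero)
  finally show ?thesis .
qed

lemma entry_mean_permute: "bij \<sigma> \<Longrightarrow> entry_mean (\<sigma> s) (\<sigma> t) = entry_mean s t"
  using entry_mean_monomial[of \<sigma> "\<lambda>_. 1" s t] by simp

lemma entry_corr_permute: "bij \<sigma> \<Longrightarrow> entry_corr (\<sigma> s) (\<sigma> t) (\<sigma> u) (\<sigma> v) = entry_corr s t u v"
  using entry_corr_monomial[of \<sigma> "\<lambda>_. 1" s t u v] by simp

lemma entry_mean_offdiag: "s \<noteq> t \<Longrightarrow> entry_mean s t = 0"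
  using entry_mean_monomial[of id "\<lambda>i. if i = s then \<i> else 1" s t]
  by (intro fixed_by_phase) (auto split: if_splits)

lemma entry_mean_diag: "entry_mean s s = entry_mean t t"
  using entry_mean_permute[of "Transposition.transpose s t" s s] by simp

text \<open>Putting the phase \<open>\<i>\<close> on one suitable index multiplies the correlation by \<open>\<plusminus>\<i>\<close> or \<open>-1\<close>.\<close>

lemma entry_corr_zero:
  assumes "\<not> (s = t \<and> u = v)" "\<not> (s = v \<and> u = t)"
  shows "entry_corr s t u v = 0"
proof -
  have m: "entry_corr s t u v = c s * cnj (c t) * c u * cnj (c v) * entry_corr s t u v"
    if "c = (\<lambda>i. if i = w then \<i> else 1)" for c w
    using entry_corr_monomial[of id c s t u v] that by auto
  consider "s \<noteq> t" "s \<noteq> v" | "s = t" "u \<noteq> v" | "s = v" "u \<noteq> t"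
    using assms by blast
  then show ?thesis
  proof cases
    case 1
    then show ?thesis using m[OF refl, of s] by (intro fixed_by_phase) (auto split: if_splits)
  next
    case 2
    then show ?thesis using m[OF refl, of u] by (intro fixed_by_phase) (auto split: if_splits)
  next
    case 3
    then show ?thesis using m[OF refl, of u] by (intro fixed_by_phase) (auto split: if_splits)
  qed
qed

text \<open>Hadamard invariance applied to the square of a diagonal entry. With x, y, z for the
  three correlations in the statement, the expansion reads 4x = 2x + 2y + 2z.\<close>

lemma entry_corr_hadamard:
  assumes "j \<noteq> k"
  shows "entry_corr j j j j = entry_corr j j k k + entry_corr j k k j"
proof -
  have e: "entry_corr j j j j = (LINT U|\<mu>. ((conjugate U $ j $ j + conjugate U $ j $ k + conjugate U $ k $ j + conjugate U $ k $ k) / 2) *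
      ((conjugate U $ j $ j + conjugate U $ j $ k + conjugate U $ k $ j + conjugate U $ k $ k) / 2))"
    unfolding entry_corr_def
    by (subst invariant[OF _ hadamard_on_unitary[OF assms], symmetric])
       (auto intro!: continuous_intros simp: conj_hadamard_on_diag[OF assms])
  have i [simp]: "integrable \<mu> (\<lambda>U. conjugate U $ a $ b * conjugate U $ c $ d / 4)" for a b c d
    by (rule integrable_conjugate) (intro continuous_intros, simp)
  have "entry_corr j j j j = (LINT U|\<mu>. (\<Sum>(a, b)\<in>{j, k} \<times> {j, k}. \<Sum>(c, d)\<in>{j, k} \<times> {j, k}.
        conjugate U $ a $ b * conjugate U $ c $ d / 4))"
    unfolding e using assms
    by (intro Bochner_Integration.integral_cong refl)
       (simp add: sum.cartesian_product[symmetric] field_simps)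
  also have "\<dots> = (\<Sum>(a, b)\<in>{j, k} \<times> {j, k}. \<Sum>(c, d)\<in>{j, k} \<times> {j, k}. entry_corr a b c d / 4)"
    by (simp add: Bochner_Integration.integral_sum case_prod_unfold entry_corr_def)
  \<comment> \<open>Ten of the sixteen index patterns vanish by \<open>entry_corr_zero\<close>;
    swapping \<open>j\<close> and \<open>k\<close> then pairs up the remaining six.\<close>
  also have "\<dots> = (entry_corr j j j j + entry_corr j j k k + entry_corr j k k j + entry_corr k j j k + entry_corr k k j j + entry_corr k k k k) / 4"
    using assms by (simp add: sum.cartesian_product[symmetric] entry_corr_zero field_simps)
  also have "entry_corr k k k k = entry_corr j j j j"
    using entry_corr_permute[of "Transposition.transpose j k" j j j j] by simp
  also have "entry_corr k k j j = entry_corr j j k k"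
    using entry_corr_permute[of "Transposition.transpose j k" j j k k] by simp
  also have "entry_corr k j j k = entry_corr j k k j"
    using entry_corr_permute[of "Transposition.transpose j k" j k k j] by simp
  finally have "2 * entry_corr j j j j = 2 * (entry_corr j j k k + entry_corr j k k j)" by (simp add: field_simps)
  then show ?thesis by (metis mult_left_cancel zero_neq_numeral)
qed

text \<open>Permutations move any two distinct indices to a fixed pair, which leaves two constants.
  When all indices coincide both summands contribute, and \<open>y + z\<close> is exactly the
  Hadamard relation. The nested conditionals test one equation each, so that later sums collapse
  index by index.\<close>

lemma entry_corr_eq:
  assumes "2 \<le> CARD('n)"
  obtains y z where "\<And>s t u v. entry_corr s t u v =
    (if s = t then if u = v then y else 0 else 0) + (if s = v then if u = t then z else 0 else 0)"
proof -
  have "\<not> CARD('n) \<le> Suc 0" using assms by simp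
  then obtain j k :: 'n where jk: "j \<noteq> k"
    using card_le_Suc0_iff_eq[of "UNIV :: 'n set"] by auto
  define y z where "y = entry_corr j j k k" and "z = entry_corr j k k j"
  have d: "entry_corr s s s s = y + z" for s
    using entry_corr_permute[of "Transposition.transpose s j" s s s s] entry_corr_hadamard[OF jk]
    by (simp add: y_def z_def)
  have o: "entry_corr s s u u = y \<and> entry_corr s u u s = z" if su: "s \<noteq> u" for s u
  proof -
    obtain \<sigma> where "bij \<sigma>" "\<sigma> s = j" "\<sigma> u = k" using ex_bij_pair[OF su jk] by blast
    then show ?thesis
      using entry_corr_permute[of \<sigma> s s u u] entry_corr_permute[of \<sigma> s u u s] by (simp add: y_def z_def)
  qed
  show ?thesis
  proof (rule that)
    fix s t u v :: 'n
    consider "s = t" "u = v" "s = u" | "s = t" "u = v" "s \<noteq> u" | "s \<noteq> t" "s = v" "u = t"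
      | "\<not> (s = t \<and> u = v)" "\<not> (s = v \<and> u = t)" by blast
    then show "entry_corr s t u v =
      (if s = t then if u = v then y else 0 else 0) + (if s = v then if u = t then z else 0 else 0)"
    proof cases
      case 4
      with entry_corr_zero show ?thesis by auto
    qed (use d o in auto)
  qed
qed

section \<open>First and second trace moments\<close>

lemma first_moment: "(LINT U|\<mu>. trace (A ** conjugate U)) = trace A * trace K / of_nat CARD('n)"
proof -
  have i [simp]: "integrable \<mu> (\<lambda>U. a * conjugate U $ s $ t)" for a s t
    by (rule integrable_conjugate) (intro continuous_intros)
  have lin: "(LINT U|\<mu>. trace (B ** conjugate U)) = (\<Sum>t\<in>UNIV. \<Sum>s\<in>UNIV. B $ t $ s * entry_mean s t)" for B
    by (simp add: trace_def matrix_matrix_mult_def Bochner_Integration.integral_sum entry_mean_def)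
  \<comment> \<open>Any index serves here, since all diagonal means agree; the mean matrix is
    \<open>e\<close> times the identity.\<close>
  define e where "e = entry_mean undefined undefined"
  have entry_mean: "entry_mean s t = (if s = t then e else 0)" for s t
    using entry_mean_offdiag entry_mean_diag e_def by auto
  have tr: "(LINT U|\<mu>. trace (B ** conjugate U)) = trace B * e" for B
    unfolding lin entry_mean by (simp add: trace_def sum_distrib_right if_distrib cong: if_cong)
  \<comment> \<open>Testing against the identity determines \<open>e\<close>, because the trace of
    \<open>conjugate U\<close> is constantly \<open>trace K\<close>.\<close>
  have "(LINT U|\<mu>. trace (mat 1 ** conjugate U)) = (LINT U|\<mu>. trace K)"
    by (intro Bochner_Integration.integral_cong) (simp_all add: space_haar[OF haar] conjugate_def trace_unitary_conj)
  then have "trace K = of_nat CARD('n) * e"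
    unfolding tr by (simp add: trace_I)
  then show ?thesis unfolding tr by simp
qed

lemma second_moment:
  assumes "2 \<le> CARD('n)"
  defines "d \<equiv> of_nat CARD('n)"
  shows "(LINT U|\<mu>. (trace (A ** conjugate U))\<^sup>2) =
    ((d * (trace K)\<^sup>2 - trace (K ** K)) * (trace A)\<^sup>2 + (d * trace (K ** K) - (trace K)\<^sup>2) * trace (A ** A))
      / (d * (d\<^sup>2 - 1))"
proof -
  obtain y z where entry_corr: "\<And>s t u v. entry_corr s t u v =
    (if s = t then if u = v then y else 0 else 0) + (if s = v then if u = t then z else 0 else 0)"
    using entry_corr_eq[OF assms(1)] by blast
  have i [simp]: "integrable \<mu> (\<lambda>U. a * (conjugate U $ s $ t * conjugate U $ u $ v))" for a s t u v
    by (rule integrable_conjugate) (intro continuous_intros)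
  have i' [simp]: "integrable \<mu> (\<lambda>U. conjugate U $ s $ t * conjugate U $ u $ v)" for s t u v
    by (rule integrable_conjugate) (intro continuous_intros)
  \<comment> \<open>Kept general in \<open>B\<close>: the case \<open>A\<close> is the goal, the
    case \<open>mat 1\<close> yields an equation for \<open>y\<close> and \<open>z\<close>.\<close>
  have sq: "(LINT U|\<mu>. (trace (B ** conjugate U))\<^sup>2) = y * (trace B)\<^sup>2 + z * trace (B ** B)" for B
  proof -
    have "(trace (B ** conjugate U))\<^sup>2 = (\<Sum>t\<in>UNIV. \<Sum>s\<in>UNIV. \<Sum>v\<in>UNIV. \<Sum>u\<in>UNIV.
        (B $ t $ s * B $ v $ u) * (conjugate U $ s $ t * conjugate U $ u $ v))" for U
      unfolding trace_def matrix_matrix_mult_def power2_eq_square vec_lambda_beta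
      unfolding sum_distrib_right unfolding sum_distrib_left by (simp only: mult_ac)
    then have "(LINT U|\<mu>. (trace (B ** conjugate U))\<^sup>2) = (\<Sum>t\<in>UNIV. \<Sum>s\<in>UNIV. \<Sum>v\<in>UNIV. \<Sum>u\<in>UNIV.
        (B $ t $ s * B $ v $ u) * entry_corr s t u v)"
      by (simp add: Bochner_Integration.integral_sum entry_corr_def)
    also have "\<dots> = (\<Sum>t\<in>UNIV. \<Sum>v\<in>UNIV. B $ t $ t * B $ v $ v * y) + (\<Sum>t\<in>UNIV. \<Sum>s\<in>UNIV. B $ t $ s * B $ s $ t * z)"
      by (simp add: entry_corr distrib_left sum.distrib if_distrib[of "\<lambda>x. _ * x"] sum_if cong: if_cong)
    finally show ?thesis
      by (simp add: trace_def matrix_matrix_mult_def power2_eq_square sum_distrib_left sum_distrib_right mult_ac)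
  qed
  have "(LINT U|\<mu>. (trace (mat 1 ** conjugate U))\<^sup>2) = (LINT U|\<mu>. (trace K)\<^sup>2)"
    by (intro Bochner_Integration.integral_cong) (simp_all add: space_haar[OF haar] conjugate_def trace_unitary_conj)
  then have e1: "d\<^sup>2 * y + d * z = (trace K)\<^sup>2"
    unfolding sq by (simp add: trace_I d_def mult_ac)
  \<comment> \<open>The second equation comes from the other conjugation invariant, the trace of the
    square.\<close>
  have "(LINT U|\<mu>. trace (conjugate U ** conjugate U)) = (LINT U|\<mu>. trace (K ** K))"
    by (intro Bochner_Integration.integral_cong)
      (simp_all add: space_haar[OF haar] conjugate_def unitary_conj_mult trace_unitary_conj)
  then have "trace (K ** K) = (LINT U|\<mu>. trace (conjugate U ** conjugate U))"
    by simp
  also have "\<dots> = (\<Sum>s\<in>UNIV. \<Sum>t\<in>UNIV. entry_corr s t t s)"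
    by (simp add: trace_def matrix_matrix_mult_def Bochner_Integration.integral_sum entry_corr_def)
  also have "\<dots> = d * y + d\<^sup>2 * z"
    by (simp add: entry_corr sum.distrib d_def power2_eq_square distrib_left mult.assoc)
  finally have e2: "d * y + d\<^sup>2 * z = trace (K ** K)" ..
  have "d \<noteq> 0" "d\<^sup>2 - 1 \<noteq> 0"
    using assms(1) of_nat_square_diff_1_neq_0[OF assms(1)] by (auto simp: d_def)
  \<comment> \<open>Cramer's rule for \<open>e1\<close> and \<open>e2\<close>: the determinant is
    \<open>d\<^sup>2 * (d\<^sup>2 - 1)\<close>, of which one factor \<open>d\<close> cancels. It is
    nonzero because the dimension is at least 2.\<close>
  moreover have "y * (d * (d\<^sup>2 - 1)) = d * (trace K)\<^sup>2 - trace (K ** K)"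
    "z * (d * (d\<^sup>2 - 1)) = d * trace (K ** K) - (trace K)\<^sup>2"
    unfolding e1[symmetric] e2[symmetric] by algebra+
  ultimately have "y = (d * (trace K)\<^sup>2 - trace (K ** K)) / (d * (d\<^sup>2 - 1))"
    "z = (d * trace (K ** K) - (trace K)\<^sup>2) / (d * (d\<^sup>2 - 1))"
    by (simp_all add: eq_divide_eq)
  then show ?thesis unfolding sq by (simp add: add_divide_distrib)
qed

end

section \<open>Skew information of pure states\<close>

lemma mat_adj_mat_adj [simp]: "mat_adj (mat_adj A) = A"
  by (simp add: mat_adj_def vec_eq_iff)

lemma mat_mult_diff_left: "A ** (B - C) = A ** B - A ** C" for A :: "complex ^ 'n ^ 'm"
  by (simp add: matrix_matrix_mult_def vec_eq_iff right_diff_distrib sum_subtractf)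

lemma mat_mult_diff_right: "(A - B) ** C = A ** C - B ** C" for A :: "complex ^ 'n ^ 'm"
  by (simp add: matrix_matrix_mult_def vec_eq_iff left_diff_distrib sum_subtractf)

lemma mat_scale_mult_left: "mat_scale c A ** B = mat_scale c (A ** B)"
  by (simp add: matrix_matrix_mult_def vec_eq_iff mat_scale_def sum_distrib_left mult.assoc)

lemma mat_scale_mult_right: "A ** mat_scale c B = mat_scale c (A ** B)"
  by (simp add: matrix_matrix_mult_def vec_eq_iff mat_scale_def sum_distrib_left mult_ac)

lemma mat_scale_mat_scale: "mat_scale a (mat_scale b A) = mat_scale (a * b) A"
  by (simp add: mat_scale_def mult.assoc)

lemma trace_mat_scale: "trace (mat_scale c A) = c * trace A"
  by (simp add: trace_def mat_scale_def sum_distrib_left)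

lemma mult_ket_bra: "A ** ket_bra v = (\<chi> i j. (A *v v) $ i * cnj (v $ j))"
  by (simp add: ket_bra_def matrix_matrix_mult_def matrix_vector_mult_def vec_eq_iff sum_distrib_right mult.assoc)

text \<open>Between the outer ket and bra stands a scalar, the expectation of \<open>A\<close> at
  \<open>v\<close>.\<close>

lemma ket_bra_sandwich: "ket_bra v ** A ** ket_bra v = mat_scale (cinner_vec v (A *v v)) (ket_bra v)"
proof -
  have "(ket_bra v ** (A ** ket_bra v)) $ i $ j = cinner_vec v (A *v v) * (v $ i * cnj (v $ j))" for i j
    unfolding mult_ket_bra
    by (simp add: matrix_matrix_mult_def ket_bra_def cinner_vec_def sum_distrib_left sum_distrib_right mult_ac)
  then show ?thesis
    by (simp add: vec_eq_iff mat_scale_def ket_bra_def flip: matrix_mul_assoc)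
qed

lemma trace_mult_ket_bra: "trace (A ** ket_bra v) = cinner_vec v (A *v v)"
  unfolding mult_ket_bra by (simp add: trace_def cinner_vec_def mult.commute)

lemma cinner_vec_adj: "cinner_vec v (A *v w) = cinner_vec (mat_adj A *v v) w"
proof -
  have "cinner_vec v (A *v w) = (\<Sum>i\<in>UNIV. \<Sum>j\<in>UNIV. cnj (v $ i) * (A $ i $ j * w $ j))"
    by (simp add: cinner_vec_def matrix_vector_mult_def sum_distrib_left)
  also have "\<dots> = (\<Sum>j\<in>UNIV. \<Sum>i\<in>UNIV. cnj (v $ i) * (A $ i $ j * w $ j))"
    by (rule sum.swap)
  also have "\<dots> = cinner_vec (mat_adj A *v v) w"
    by (simp add: cinner_vec_def matrix_vector_mult_def mat_adj_def sum_distrib_right sum_distrib_left mult_ac)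
  finally show ?thesis .
qed

lemma cinner_vec_self: "cinner_vec v v = of_real ((norm v)\<^sup>2)"
proof -
  have "(norm v)\<^sup>2 = (\<Sum>i\<in>UNIV. (cmod (v $ i))\<^sup>2)"
    by (simp add: norm_vec_def L2_set_def sum_nonneg)
  then show ?thesis
    by (simp add: cinner_vec_def complex_norm_square mult.commute del: of_real_power)
qed

lemma mat_adj_ket_bra: "mat_adj (ket_bra v) = ket_bra v"
  by (simp add: mat_adj_def ket_bra_def vec_eq_iff mult.commute)

lemma ket_bra_mult_vec: "ket_bra v *v w = cinner_vec v w *s v"
  by (simp add: ket_bra_def matrix_vector_mult_def cinner_vec_def vec_eq_iff sum_distrib_left sum_distrib_right mult_ac)

lemma ket_bra_idem:
  assumes "norm v = 1"
  shows "ket_bra v ** ket_bra v = ket_bra v"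
  using ket_bra_sandwich[of v "mat 1"] assms
  by (simp add: cinner_vec_self mat_scale_def vec_eq_iff)

text \<open>The squared norm of \<open>A *v x\<close> is the quadratic form of
  \<open>mat_adj A ** A\<close> at \<open>x\<close>.\<close>

lemma mat_eq_0_if_adj_mult_eq_0:
  assumes "mat_adj A ** A = 0"
  shows "A = 0"
proof -
  have "A *v x = 0" for x
  proof -
    have "cinner_vec (A *v x) (A *v x) = cinner_vec x ((mat_adj A ** A) *v x)"
      using cinner_vec_adj[of x "mat_adj A" "A *v x"] by (simp add: matrix_vector_mul_assoc)
    then show ?thesis using assms by (simp add: cinner_vec_self) (simp add: cinner_vec_def)
  qed
  then show ?thesis by (simp add: matrix_eq)
qed

text \<open>The quadratic form at \<open>w\<close> is the squared modulus of
  \<open>cinner_vec v w\<close>.\<close>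

lemma pos_semidef_ket_bra: "pos_semidef (ket_bra v)"
proof -
  have "cinner_vec w (ket_bra v *v w) = cinner_vec v w * cnj (cinner_vec v w)" for w
  proof -
    have "cinner_vec w (ket_bra v *v w) = cinner_vec v w * (\<Sum>i\<in>UNIV. cnj (w $ i) * v $ i)"
      by (simp add: ket_bra_mult_vec) (simp add: cinner_vec_def[of w] sum_distrib_left mult_ac)
    also have "(\<Sum>i\<in>UNIV. cnj (w $ i) * v $ i) = cnj (cinner_vec v w)"
      by (simp add: cinner_vec_def mult.commute)
    finally show ?thesis .
  qed
  also have "\<dots> w = of_real ((cmod (cinner_vec v w))\<^sup>2)" for w
    by (rule complex_norm_square[symmetric])
  finally show ?thesis by (simp add: pos_semidef_def hermitian_def mat_adj_ket_bra)
qed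

text \<open>As \<open>mat_sqrt\<close> is a definite description, uniqueness is the main point:
  every root is a multiple \<open>l\<close> of the projector with \<open>l * l = 1\<close>, and
  positivity at \<open>v\<close> excludes -1.\<close>

lemma mat_sqrt_ket_bra:
  assumes "norm v = 1"
  shows "mat_sqrt (ket_bra v) = ket_bra v"
proof -
  let ?P = "ket_bra v"
  have "S = ?P" if S: "pos_semidef S" "S ** S = ?P" for S
  proof -
    define l where "l = cinner_vec v (S *v v)"
    have adj: "mat_adj S = S" using S(1) by (simp add: pos_semidef_def hermitian_def)
    \<comment> \<open>A matrix commutes with its own square.\<close>
    have comm: "S ** ?P = ?P ** S" using S(2) by (metis matrix_mul_assoc)
    \<comment> \<open>\<open>D = S (1 - P)\<close> vanishes because \<open>D\<^sup>\<dagger> D = (1 - P) S\<^sup>2 (1 - P) = 0\<close>; hence \<open>S = S P = P S P\<close>.\<close>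
    define D where "D = S - S ** ?P"
    have aD: "mat_adj D = S - ?P ** S"
    proof -
      have "mat_adj D = mat_adj S - mat_adj (S ** ?P)"
        by (simp add: D_def mat_adj_def vec_eq_iff)
      then show ?thesis by (simp add: mat_adj_mult adj mat_adj_ket_bra)
    qed
    have "mat_adj D ** D = S ** S - S ** S ** ?P - ?P ** (S ** S) + ?P ** (S ** S) ** ?P"
      unfolding aD unfolding D_def
      by (simp add: mat_mult_diff_left mat_mult_diff_right matrix_mul_assoc)
    also have "\<dots> = 0" by (simp add: S(2) ket_bra_idem[OF assms])
    finally have "D = 0" by (rule mat_eq_0_if_adj_mult_eq_0)
    then have "S = S ** ?P ** ?P" by (simp add: D_def ket_bra_idem[OF assms] flip: matrix_mul_assoc)
    then have SP: "S = mat_scale l ?P"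
      unfolding comm ket_bra_sandwich l_def .
    have "?P = mat_scale (l * l) ?P"
      using S(2) unfolding SP
      by (simp add: mat_scale_mult_left mat_scale_mult_right mat_scale_mat_scale ket_bra_idem[OF assms])
    moreover obtain i where i: "v $ i \<noteq> 0" using assms by (metis norm_zero vec_eq_iff zero_index zero_neq_one)
    ultimately have "l * l = 1"
      by (auto simp: vec_eq_iff mat_scale_def ket_bra_def dest!: spec[of _ i])
    then have "l = 1 \<or> l = -1" by (simp add: square_eq_1_iff)
    moreover have "0 \<le> Re l" using S(1) by (simp add: pos_semidef_def l_def)
    ultimately have "l = 1" by auto
    then show ?thesis by (subst SP) (simp add: mat_scale_def vec_eq_iff)
  qed
  then show ?thesis
    unfolding mat_sqrt_def using pos_semidef_ket_bra ket_bra_idem[OF assms] by (intro the_equality) auto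
qed

text \<open>The projector is its own square root. Expanding the squared commutator and using
  cyclicity of the trace leaves twice the squared expectation minus twice the expectation of the
  square.\<close>

lemma skew_information_pure:
  assumes "norm v = 1"
  shows "skew_information (ket_bra v) H = cinner_vec v (H *v (H *v v)) - (cinner_vec v (H *v v))\<^sup>2"
proof -
  let ?P = "ket_bra v"
  have "commutator ?P H ** commutator ?P H =
    ?P ** H ** ?P ** H - ?P ** H ** H ** ?P - H ** (?P ** ?P) ** H + H ** ?P ** H ** ?P"
    by (simp add: commutator_def mat_mult_diff_left mat_mult_diff_right matrix_mul_assoc)
  then have "trace (commutator ?P H ** commutator ?P H) =
    trace (?P ** H ** ?P ** H) - trace (?P ** H ** H ** ?P) - trace (H ** ?P ** H) + trace (H ** ?P ** H ** ?P)"
    by (simp add: trace_add trace_sub ket_bra_idem[OF assms])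
  moreover have "trace (?P ** H ** ?P ** H) = (cinner_vec v (H *v v))\<^sup>2"
    by (simp add: ket_bra_sandwich mat_scale_mult_left trace_mat_scale trace_mult_ket_bra
       trace_mul_sym[of ?P] power2_eq_square)
  moreover have "trace (H ** ?P ** H ** ?P) = trace (?P ** H ** ?P ** H)"
    using trace_mul_sym[of H "?P ** H ** ?P"] by (simp add: matrix_mul_assoc)
  moreover have "trace (H ** ?P ** H) = trace (H ** H ** ?P)"
    using trace_mul_sym[of "H ** ?P" H] by (simp add: matrix_mul_assoc)
  moreover have "trace (?P ** H ** H ** ?P) = trace (H ** H ** ?P)"
    using trace_mul_sym[of "?P ** H ** H" ?P] trace_mul_sym[of ?P "H ** H"]
    by (simp add: matrix_mul_assoc ket_bra_idem[OF assms])
  ultimately show ?thesis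
    by (simp add: skew_information_def mat_sqrt_ket_bra[OF assms] trace_mult_ket_bra matrix_vector_mul_assoc
        diff_divide_distrib)
qed

section \<open>Noncovariance of isometric channels\<close>

text \<open>Column-stacking vectorization: the matrix unit with row s and column k becomes the basis
  vector (k, s), the \<open>L\<close> index first.\<close>

definition vec_of :: "complex ^ 'l ^ 's \<Rightarrow> complex ^ ('l::finite \<times> 's::finite)" where
  "vec_of M = (\<chi> p. M $ snd p $ fst p)"

lemma vec_of_diff: "vec_of (M - N) = vec_of M - vec_of N"
  by (simp add: vec_of_def vec_eq_iff)

text \<open>The standard vectorization identity; it is the source of the transposed
  \<open>H\<^sub>L\<close> in the formulas below.\<close>

lemma kron_mult_vec_of: "kron X Y *v vec_of M = vec_of (Y ** M ** transpose X)"
proof -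
  have "(kron X Y *v vec_of M) $ (i, s) = vec_of (Y ** M ** transpose X) $ (i, s)" for i s
  proof -
    have "(kron X Y *v vec_of M) $ (i, s) = (\<Sum>(j, t)\<in>UNIV \<times> UNIV. X $ i $ j * Y $ s $ t * M $ t $ j)"
      by (simp add: matrix_vector_mult_def kron_def vec_of_def case_prod_unfold)
    also have "\<dots> = (\<Sum>j\<in>UNIV. \<Sum>t\<in>UNIV. X $ i $ j * Y $ s $ t * M $ t $ j)"
      by (simp only: sum.cartesian_product)
    finally show ?thesis
      by (simp add: vec_of_def matrix_matrix_mult_def transpose_def sum_distrib_left sum_distrib_right mult_ac)
  qed
  then show ?thesis by (simp add: vec_eq_iff split_paired_all)
qed

text \<open>On the matrix side this is the Hilbert-Schmidt inner product.\<close>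

lemma cinner_vec_of: "cinner_vec (vec_of M) (vec_of N) = trace (mat_adj M ** N)"
proof -
  have "cinner_vec (vec_of M) (vec_of N) = (\<Sum>(j, t)\<in>UNIV \<times> UNIV. cnj (M $ t $ j) * N $ t $ j)"
    by (simp add: cinner_vec_def vec_of_def case_prod_unfold)
  also have "\<dots> = (\<Sum>j\<in>UNIV. \<Sum>t\<in>UNIV. cnj (M $ t $ j) * N $ t $ j)"
    by (simp only: sum.cartesian_product)
  finally show ?thesis by (simp add: trace_def matrix_matrix_mult_def mat_adj_def)
qed

lemma max_entangled_eq_vec_of:
  "(max_entangled :: complex ^ ('l::finite \<times> 'l))
    = vec_of (mat_scale (1 / of_real (sqrt (real CARD('l)))) (mat 1))"
  by (simp add: max_entangled_def vec_of_def mat_scale_def mat_def vec_eq_iff)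

lemma trace_transpose: "trace (transpose A) = trace A"
  by (simp add: trace_def transpose_def)

lemma mat_adj_mat_scale: "mat_adj (mat_scale c A) = mat_scale (cnj c) (mat_adj A)"
  by (simp add: mat_adj_def mat_scale_def vec_eq_iff)

lemma mat_scale_diff: "mat_scale c A - mat_scale c B = mat_scale c (A - B)"
  by (simp add: mat_scale_def vec_eq_iff right_diff_distrib)

text \<open>The Choi vector is the vectorization of a multiple of \<open>W\<close>, so the two
  expectations in the variance become traces. Cyclicity brings them to the form of the Haar moments,
  and terms in \<open>H\<^sub>L\<close> alone lose \<open>W\<close> because it is an
  isometry.\<close>

lemma noncovariance_isometric_channel:
  fixes W :: "complex ^ 'l::finite ^ 's::finite"
  assumes W: "mat_adj W ** W = mat 1"
  shows "noncovariance (rep_of (mat_cnj H\<^sub>L)) (rep_of H\<^sub>S) (isometric_channel W)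
    = (trace (H\<^sub>S ** H\<^sub>S ** (W ** mat_adj W)) - 2 * trace (H\<^sub>S ** (W ** transpose H\<^sub>L ** mat_adj W))
        + trace (H\<^sub>L ** H\<^sub>L)) / of_nat CARD('l)
      - ((trace (H\<^sub>S ** (W ** mat_adj W)) - trace H\<^sub>L) / of_nat CARD('l))\<^sup>2"
proof -
  define c :: complex where "c = 1 / of_real (sqrt (real CARD('l)))"
  define L where "L = transpose H\<^sub>L"
  define H where "H = kron (mat 1) H\<^sub>S - kron H\<^sub>L (mat 1)"
  define v where "v = vec_of (mat_scale c W)"
  have cc: "cnj c * c = 1 / of_nat CARD('l)"
    by (simp add: c_def flip: of_real_mult)
  have v: "kron (mat 1) W *v max_entangled = v"
    by (simp add: max_entangled_eq_vec_of kron_mult_vec_of v_def c_def mat_scale_mult_right)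
  \<comment> \<open>Stated for arbitrary \<open>M\<close> so that it can be applied twice for the
    square of the generator.\<close>
  have H: "H *v vec_of (mat_scale c M) = vec_of (mat_scale c (H\<^sub>S ** M - M ** L))" for M
    by (simp add: H_def matrix_vector_mult_diff_rdistrib kron_mult_vec_of L_def mat_scale_mult_right
        mat_scale_mult_left mat_scale_diff flip: vec_of_diff)
  have ip: "cinner_vec v (vec_of (mat_scale c M)) = trace (mat_adj W ** M) / of_nat CARD('l)" for M
    using cc by (simp add: mult.commute[of c] v_def cinner_vec_of mat_adj_mat_scale mat_scale_mult_left mat_scale_mult_right
        mat_scale_mat_scale trace_mat_scale)
  have "cinner_vec v v = 1"
    using ip[of W] by (simp add: v_def[symmetric] W trace_I)
  then have "(norm v)\<^sup>2 = 1"
    by (simp only: cinner_vec_self of_real_eq_1_iff)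
  then have nv: "norm v = 1"
    using norm_ge_zero[of v] by (auto simp: power2_eq_1_iff)
  have cyc: "trace (mat_adj W ** M) = trace (M ** mat_adj W)" for M
    by (rule trace_mul_sym)
  have WL: "trace (mat_adj W ** (W ** X)) = trace X" for X
    by (simp add: matrix_mul_assoc W)
  have "trace (mat_adj W ** (H\<^sub>S ** W - W ** L)) = trace (H\<^sub>S ** (W ** mat_adj W)) - trace H\<^sub>L"
    by (simp add: mat_mult_diff_left trace_sub WL cyc[of "H\<^sub>S ** W"])
       (simp add: L_def trace_transpose matrix_mul_assoc)
  then have e1: "cinner_vec v (H *v v) = (trace (H\<^sub>S ** (W ** mat_adj W)) - trace H\<^sub>L) / of_nat CARD('l)"
    unfolding v_def H unfolding ip[unfolded v_def] by simp
  have "trace (mat_adj W ** (H\<^sub>S ** (H\<^sub>S ** W - W ** L) - (H\<^sub>S ** W - W ** L) ** L)) =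
    trace (mat_adj W ** (H\<^sub>S ** H\<^sub>S ** W)) - 2 * trace (mat_adj W ** (H\<^sub>S ** W ** L)) + trace (mat_adj W ** (W ** (L ** L)))"
    unfolding mat_mult_diff_left mat_mult_diff_right trace_sub by (simp add: matrix_mul_assoc)
  also have "\<dots> = trace (H\<^sub>S ** H\<^sub>S ** (W ** mat_adj W)) - 2 * trace (H\<^sub>S ** (W ** L ** mat_adj W))
        + trace (H\<^sub>L ** H\<^sub>L)"
    unfolding WL unfolding cyc by (simp add: matrix_mul_assoc) (simp add: L_def trace_transpose flip: matrix_transpose_mul)
  finally have e2: "cinner_vec v (H *v (H *v v)) = (trace (H\<^sub>S ** H\<^sub>S ** (W ** mat_adj W))
      - 2 * trace (H\<^sub>S ** (W ** L ** mat_adj W)) + trace (H\<^sub>L ** H\<^sub>L)) / of_nat CARD('l)"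
    unfolding v_def H unfolding ip[unfolded v_def] by simp
  show ?thesis
    unfolding noncovariance_def generator_kron_rep choi_state_isometric_channel v H_def[symmetric]
      skew_information_pure[OF nv] e1 e2 L_def ..
qed

section \<open>The encoding isometry and the average\<close>

lemma attach_isometry:
  assumes "norm a = 1"
  shows "mat_adj (attach a) ** attach a = (mat 1 :: complex ^ 'l ^ 'l::finite)"
proof -
  have "(\<Sum>b\<in>UNIV. cnj (a $ b) * a $ b) = 1"
    using cinner_vec_self[of a] assms by (simp add: cinner_vec_def)
  \<comment> \<open>The sum over index pairs separates into a Kronecker delta on \<open>L\<close>
    and the squared norm of \<open>a\<close>.\<close>
  moreover have "(mat_adj (attach a) ** attach a) $ i $ j
      = (\<Sum>k\<in>UNIV. \<Sum>b\<in>UNIV. if k = i then if k = j then cnj (a $ b) * a $ b else 0 else 0)" for i j :: 'l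
  proof -
    have "(mat_adj (attach a) ** attach a) $ i $ j
      = (\<Sum>(k, b)\<in>UNIV \<times> UNIV. if k = i then if k = j then cnj (a $ b) * a $ b else 0 else 0)"
      by (simp add: matrix_matrix_mult_def mat_adj_def attach_def case_prod_unfold) (rule sum.cong, auto)
    then show ?thesis by (simp only: sum.cartesian_product)
  qed
  ultimately show ?thesis by (simp add: vec_eq_iff mat_def sum_if)
qed

text \<open>Here \<open>l\<close>, \<open>d\<close> are the dimensions, \<open>s\<close>,
  \<open>ss\<close> the traces of \<open>H\<^sub>S\<close> and its square, and \<open>t\<close>,
  \<open>tt\<close> those of \<open>H\<^sub>L\<close>. The left side is the variance with the
  moments inserted.\<close>

lemma average_arithmetic:
  fixes l d s ss t tt :: complex
  assumes "l \<noteq> 0" "d \<noteq> 0" "d\<^sup>2 - 1 \<noteq> 0"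
  shows "(ss * l / d - 2 * (s * t / d) + tt) / l
     - (((d * l\<^sup>2 - l) * s\<^sup>2 + (d * l - l\<^sup>2) * ss) / (d * (d\<^sup>2 - 1)) + t\<^sup>2 - 2 * (s * l / d) * t) / l\<^sup>2
   = (l * tt - t\<^sup>2) / l\<^sup>2 + ((l * d\<^sup>2 - d) * ss - (l * d - 1) * s\<^sup>2) / (l * d * (d\<^sup>2 - 1))"
proof -
  \<comment> \<open>Treating the factor as an atom lets denominators be cleared; its relation to
    \<open>d\<close> is restored only for the final polynomial identity.\<close>
  define e where "e = d\<^sup>2 - 1"
  have e0: "e \<noteq> 0" using assms(3) by (simp add: e_def)
  have d2: "d\<^sup>2 = e + 1" by (simp add: e_def)
  show ?thesis unfolding e_def[symmetric] using assms(1,2) e0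
    by (simp add: field_simps power2_eq_square)
       (use d2 in algebra)
qed

theorem mainTheorem4:
  fixes H\<^sub>L :: "complex ^ 'l::finite ^ 'l"
    and H\<^sub>S :: "complex ^ ('l::finite \<times> 'a::finite) ^ ('l \<times> 'a)"
    and a\<^sub>0 :: "complex ^ 'a"
    and \<mu> :: "(complex ^ ('l \<times> 'a) ^ ('l \<times> 'a)) measure"
  defines "d\<^sub>L \<equiv> (of_nat CARD('l) :: complex)"
    and "d\<^sub>S \<equiv> (of_nat CARD('l \<times> 'a) :: complex)"
    and "N \<equiv> (\<lambda>U. noncovariance (rep_of (mat_cnj H\<^sub>L)) (rep_of H\<^sub>S) (encoding_channel a\<^sub>0 U))"
  assumes "CARD('l \<times> 'a) \<ge> 2"
    and "norm a\<^sub>0 = 1"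
    and "hermitian H\<^sub>L" and "hermitian H\<^sub>S"
    and "normalized_haar \<mu>"
  shows "integrable \<mu> N \<and>
    (LINT U|\<mu>. N U) =
      (d\<^sub>L * trace (H\<^sub>L ** H\<^sub>L) - (trace H\<^sub>L)\<^sup>2) / d\<^sub>L\<^sup>2
      + ((d\<^sub>L * d\<^sub>S\<^sup>2 - d\<^sub>S) * trace (H\<^sub>S ** H\<^sub>S) - (d\<^sub>L * d\<^sub>S - 1) * (trace H\<^sub>S)\<^sup>2)
        / (d\<^sub>L * d\<^sub>S * (d\<^sub>S\<^sup>2 - 1))"
proof -
  note haar = \<open>normalized_haar \<mu>\<close>
  define V :: "complex ^ 'l ^ ('l \<times> 'a)" where "V = attach a\<^sub>0"
  have V: "mat_adj V ** V = mat 1"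
    unfolding V_def by (rule attach_isometry) fact
  \<comment> \<open>With W = U V, conjugating \<open>K\<close> by \<open>U\<close> gives
    \<open>W ** mat_adj W\<close>, and conjugating \<open>K'\<close> gives the corresponding
    expression with the transposed \<open>H\<^sub>L\<close> in the middle.\<close>
  define K where "K = V ** mat_adj V"
  define K' where "K' = V ** transpose H\<^sub>L ** mat_adj V"
  have trK: "trace K = d\<^sub>L"
    using trace_mul_sym[of V "mat_adj V"] by (simp add: K_def V trace_I d\<^sub>L_def)
  have "K ** K = V ** (mat_adj V ** V) ** mat_adj V"
    by (simp add: K_def matrix_mul_assoc)
  then have KK: "K ** K = K" by (simp add: V K_def)
  have trK': "trace K' = trace H\<^sub>L"
    unfolding K'_def trace_mul_sym[of _ "mat_adj V"] by (simp add: matrix_mul_assoc V trace_transpose)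
  interpret P: haar_conjugation \<mu> K by unfold_locales (rule haar)
  interpret Q: haar_conjugation \<mu> K' by unfold_locales (rule haar)
  let ?t0 = "\<lambda>U. trace (H\<^sub>S ** P.conjugate U)"
  let ?t1 = "\<lambda>U. trace (H\<^sub>S ** Q.conjugate U)"
  let ?t2 = "\<lambda>U. trace (H\<^sub>S ** H\<^sub>S ** P.conjugate U)"
  \<comment> \<open>The squared difference is expanded so that integration meets only first moments,
    one second moment and constants.\<close>
  define g where "g U = (?t2 U - 2 * ?t1 U + trace (H\<^sub>L ** H\<^sub>L)) / d\<^sub>L
      - ((?t0 U)\<^sup>2 + (trace H\<^sub>L)\<^sup>2 - 2 * ?t0 U * trace H\<^sub>L) / d\<^sub>L\<^sup>2" for U
  have [simp]: "integrable \<mu> (\<lambda>U. (?t0 U)\<^sup>2)" "integrable \<mu> ?t0" "integrable \<mu> ?t1" "integrable \<mu> ?t2"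
    by (intro P.integrable_conjugate Q.integrable_conjugate continuous_intros)+
  have [simp]: "integrable \<mu> (\<lambda>_. c)" for c :: complex
    by (intro haar_integrable haar continuous_intros)
  \<comment> \<open>On the space of \<open>\<mu>\<close> the matrix \<open>U\<close> is unitary,
    which makes \<open>U ** V\<close> an isometry.\<close>
  have Ng: "N U = g U" if "U \<in> space \<mu>" for U
  proof -
    have "mat_adj U ** U = mat 1" using that by (simp add: space_haar[OF haar] unitary_group_def)
    moreover have "mat_adj (U ** V) ** (U ** V) = mat_adj V ** (mat_adj U ** U) ** V"
      by (simp only: mat_adj_mult matrix_mul_assoc)
    ultimately have "mat_adj (U ** V) ** (U ** V) = mat 1" by (simp add: V)
    from noncovariance_isometric_channel[OF this, of H\<^sub>L H\<^sub>S] show ?thesis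
      unfolding N_def g_def encoding_channel_def encoding_isometry_def V_def[symmetric]
        P.conjugate_def Q.conjugate_def
      unfolding K_def K'_def
      by (simp add: mat_adj_mult matrix_mul_assoc d\<^sub>L_def power_divide power2_diff)
  qed
  have "integrable \<mu> N \<longleftrightarrow> integrable \<mu> g"
    by (rule Bochner_Integration.integrable_cong) (auto simp: Ng)
  moreover have "integrable \<mu> g" unfolding g_def by simp
  moreover have "(LINT U|\<mu>. N U) = (LINT U|\<mu>. g U)"
    by (rule Bochner_Integration.integral_cong) (auto simp: Ng)
  moreover have "(LINT U|\<mu>. g U) = ((LINT U|\<mu>. ?t2 U) - 2 * (LINT U|\<mu>. ?t1 U) + trace (H\<^sub>L ** H\<^sub>L)) / d\<^sub>L
      - ((LINT U|\<mu>. (?t0 U)\<^sup>2) + (trace H\<^sub>L)\<^sup>2 - 2 * (LINT U|\<mu>. ?t0 U) * trace H\<^sub>L) / d\<^sub>L\<^sup>2"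
    unfolding g_def by simp
  moreover have "d\<^sub>L \<noteq> 0" "d\<^sub>S \<noteq> 0"
    by (simp_all add: d\<^sub>L_def d\<^sub>S_def)
  moreover have "d\<^sub>S\<^sup>2 - 1 \<noteq> 0"
    unfolding d\<^sub>S_def by (rule of_nat_square_diff_1_neq_0) fact
  ultimately show ?thesis
    unfolding P.first_moment Q.first_moment P.second_moment[OF assms(4)] KK trK trK' d\<^sub>S_def[symmetric]
    by (simp only: average_arithmetic simp_thms)
qed

end
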